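(* Consider the Kuramoto-Sakaguchi model $$\dot x_i=f_i(\bm{x})=\omega_i-\sum_{j=1}^n a_{ij}\left[\sin(x_i-x_j-\varphi)+\sin\varphi\right],\qquad i=1,\dots,n,$$ with $\omega_i\in\mathbb{R}$, on a weighted, connected, undirected graph $\mathcal G$, with frustration parameter $\varphi\in[0,\pi/2]$. Let $\lambda_2$ and $d_{\max}$ be the algebraic connectivity and the maximal (weighted) degree of $\mathcal G$, and define $$\bar\gamma=\arctan\left[\frac{\lambda_2}{d_{\max}\tan(\varphi)}\right].$$ Then for every $0<\gamma<\bar\gamma$ the Kuramoto-Sakaguchi model is strongly infinitesimally semicontracting in the $\gamma$-cohesive set $\Delta_{\mathcal G}(\gamma)$ with respect to the $(\ell_2,\Pi_n)$ consensus seminorm; that is, there exists $c>0$ such that $\mu_{2,\Pi_n}(Df(\bm{x}))\le -c$ for all $\bm{x}\in\Delta_{\mathcal G}(\gamma)$, where $Df(\bm{x})$ is the Jacobian matrix of $f=(f_1,\dots,f_n)$.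
   Context: $\mathcal G$ is a weighted, undirected, connected graph (without self-loops) on $n\ge 2$ vertices, with symmetric weights $a_{ij}=a_{ji}$, where $a_{ij}>0$ if $(i,j)$ is an edge and $a_{ij}=0$ otherwise. Its Laplacian $L_{\mathcal G}$ has entries $-a_{ij}$ for $i\ne j$ and $\sum_k a_{ik}$ on the diagonal; its second smallest eigenvalue $\lambda_2>0$ is the algebraic connectivity. The weighted degree of vertex $i$ is $\sum_j a_{ij}$, and $d_{\max}$ is the maximum of these. Convention for the endpoints: $\bar\gamma\in(0,\pi/2)$ for $\varphi\in(0,\pi/2)$; for $\varphi=0$ the formula is read as $\bar\gamma=\pi/2$, and for $\varphi=\pi/2$ as $\bar\gamma=0$ (so that the claim is then vacuous). Counterclockwise difference: for $x_1,x_2\in\mathbb{R}$, $d_{\rm cc}(x_1,x_2)=x_1-x_2+2\pi k$ with $k\in\mathbb{Z}$ such that the value lies in $[-\pi,\pi)$. A state $\bm{x}\in\mathbb{R}^n$ is $\gamma$-cohesive if $|d_{\rm cc}(x_i,x_j)|\le\gamma$ for every edge $(i,j)$ of $\mathcal G$; $\Delta_{\mathcal G}(\gamma)$ is the set of all $\gamma$-cohesive states. Consensus seminorm: let $R\in\mathbb{R}^{(n-1)\times n}$ have rows forming an orthonormal basis of $\bm{1}_n^\perp$ ($\bm{1}_n$ the all-ones vector), so $R^\dagger=R^\top$, and let $\Pi_n=R^\top R=I_n-\frac1n\bm{1}_n\bm{1}_n^\top$. Then $\|\bm{x}\|_{2,\Pi_n}=\|\Pi_n\bm{x}\|_2=\|R\bm{x}\|_2$.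 The induced matrix seminorm is $\|A\|_{2,\Pi_n}=\max\{\|A\bm{x}\|_{2,\Pi_n}:\bm{x}\perp\bm{1}_n,\ \|\bm{x}\|_{2,\Pi_n}=1\}$ and the logarithmic seminorm is $\mu_{2,\Pi_n}(A)=\lim_{h\to0^+}\frac{\|I_n+hA\|_{2,\Pi_n}-1}{h}$; equivalently $\mu_{2,\Pi_n}(A)=\lambda_{\max}\big(R\frac{A+A^\top}{2}R^\top\big)$. *)

theory Defs
  imports "HOL-Analysis.Analysis" "HOL-Computational_Algebra.Polynomial"
begin

text \<open>
  A weighted graph on the vertex type is given by its weight matrix;
  \<open>(i, j)\<close> is an edge iff \<open>a $ i $ j > 0\<close>.
\<close>

definition edges :: "real^'n^'n \<Rightarrow> ('n \<times> 'n) set" where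
  "edges a = {(i, j). a $ i $ j > 0}"

definition connected_weighted_graph :: "real^'n^'n \<Rightarrow> bool" where
  "connected_weighted_graph a \<longleftrightarrow>
     (\<forall>i j. a $ i $ j \<ge> 0) \<and> (\<forall>i j. a $ i $ j = a $ j $ i) \<and> (\<forall>i. a $ i $ i = 0) \<and>
     (\<forall>i j. (i, j) \<in> (edges a)\<^sup>*)"

definition weighted_degree :: "real^'n^'n \<Rightarrow> 'n::finite \<Rightarrow> real" where
  "weighted_degree a i = (\<Sum>j\<in>UNIV. a $ i $ j)"

definition max_degree :: "real^'n^'n \<Rightarrow> real" where
  "max_degree a = Max (range (weighted_degree a))"

definition laplacian :: "real^'n^'n \<Rightarrow> real^'n^'n" where
  "laplacian a = (\<chi> i j. if i = j then weighted_degree a i else - a $ i $ j)"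

definition charpoly :: "real^'n^'n \<Rightarrow> real poly" where
  "charpoly A = det (\<chi> i j. (if i = j then [:0, 1:] else 0) - [:A $ i $ j:])"

text \<open>
  Real eigenvalues with algebraic multiplicity, in increasing order. For a symmetric
  matrix these are all the eigenvalues, so the list has length \<open>CARD('n)\<close>.
\<close>

definition sorted_eigenvalues :: "real^'n^'n \<Rightarrow> real list" where
  "sorted_eigenvalues A = sorted_list_of_multiset (proots (charpoly A))"

text \<open>Second smallest Laplacian eigenvalue (list positions start at 0).\<close>

definition algebraic_connectivity :: "real^'n^'n \<Rightarrow> real" where
  "algebraic_connectivity a = sorted_eigenvalues (laplacian a) ! 1"

definition d_cc :: "real \<Rightarrow> real \<Rightarrow> real" where
  "d_cc x y = (THE d. (\<exists>k::int. d = x - y + 2 * pi * of_int k) \<and> - pi \<le> d \<and> d < pi)"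

definition cohesive_set :: "real^'n^'n \<Rightarrow> real \<Rightarrow> (real^'n) set" where
  "cohesive_set a \<gamma> = {x. \<forall>(i, j)\<in>edges a. \<bar>d_cc (x $ i) (x $ j)\<bar> \<le> \<gamma>}"

definition consensus_proj :: "real^'n^'n" where
  "consensus_proj = mat 1 - (\<chi> i j. 1 / real CARD('n))"

definition consensus_seminorm :: "real^'n \<Rightarrow> real" where
  "consensus_seminorm x = norm (consensus_proj *v x)"

text \<open>
  The supremum is over a compact set, nonempty when \<open>CARD('n) \<ge> 2\<close>, hence a maximum.
  In the vector space \<open>real^'n\<close>, \<open>1\<close> is the all-ones vector.
\<close>

definition consensus_mat_seminorm :: "real^'n^'n \<Rightarrow> real" where
  "consensus_mat_seminorm A =
     (SUP x\<in>{x. x \<bullet> 1 = 0 \<and> consensus_seminorm x = 1}. consensus_seminorm (A *v x))"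

text \<open>
  The limit always exists for \<open>CARD('n) \<ge> 2\<close>: the matrix seminorm is convex and equals 1
  at the identity, so the quotient is monotone in \<open>h\<close> and bounded below.
\<close>

definition consensus_log_seminorm :: "real^'n^'n \<Rightarrow> real" where
  "consensus_log_seminorm A =
     Lim (at_right 0) (\<lambda>h. (consensus_mat_seminorm (mat 1 + h *\<^sub>R A) - 1) / h)"

definition strongly_infinitesimally_semicontracting ::
    "(real^'n \<Rightarrow> real^'n) \<Rightarrow> (real^'n) set \<Rightarrow> bool" where
  "strongly_infinitesimally_semicontracting f S \<longleftrightarrow>
     (\<exists>c>0. \<forall>x\<in>S. consensus_log_seminorm (jacobian f (at x)) \<le> - c)"

definition kuramoto_sakaguchi ::
    "real^'n^'n \<Rightarrow> real^'n \<Rightarrow> real \<Rightarrow> real^'n \<Rightarrow> real^'n" where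
  "kuramoto_sakaguchi a \<omega> \<phi> x =
     (\<chi> i. \<omega> $ i - (\<Sum>j\<in>UNIV. a $ i $ j * (sin (x $ i - x $ j - \<phi>) + sin \<phi>)))"

text \<open>
  At the endpoints the arctan formula is read by its limits; explicit cases are needed
  because division by zero is zero in HOL.
\<close>

definition gamma_bar :: "real^'n^'n \<Rightarrow> real \<Rightarrow> real" where
  "gamma_bar a \<phi> =
     (if \<phi> = 0 then pi / 2
      else if \<phi> = pi / 2 then 0
      else arctan (algebraic_connectivity a / (max_degree a * tan \<phi>)))"

end

theory Submission
  imports Defs
begin

text \<open>
  Two facts carry the proof. First, the logarithmic seminorm is a maximal Rayleigh quotient,
  \<open>\<mu>(A) = max {y \<bullet> A y | y \<bottom> 1, norm y = 1}\<close>: to first order in \<open>h\<close> the length of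
  \<open>y + h A y\<close> is \<open>1 + h (y \<bullet> A y)\<close>, and the second-order error is uniform in \<open>y\<close>
  (\<open>consensus_log_seminorm_eq_Sup_Rayleigh\<close>).

  Second, the Jacobian acts on \<open>y\<close> by
  \<open>(J y)\<^sub>i = - (\<Sum>j. a\<^sub>i\<^sub>j cos (\<theta>\<^sub>i\<^sub>j - \<phi>) (y\<^sub>i - y\<^sub>j))\<close> with \<open>\<theta>\<^sub>i\<^sub>j = x\<^sub>i - x\<^sub>j\<close>. Expand
  \<open>cos (\<theta> - \<phi>) = cos \<theta> cos \<phi> + sin \<theta> sin \<phi>\<close>. The cosine weights are symmetric and
  contribute a Laplacian form; the sine weights are antisymmetric, so that their off-diagonal part
  cancels and only a diagonal form remains:
  \<open>y \<bullet> J y = - cos \<phi> (\<Sum>i j. a\<^sub>i\<^sub>j cos \<theta>\<^sub>i\<^sub>j (y\<^sub>i - y\<^sub>j)\<^sup>2) / 2 - sin \<phi> (\<Sum>i. y\<^sub>i\<^sup>2 (\<Sum>j. a\<^sub>i\<^sub>j sin \<theta>\<^sub>i\<^sub>j))\<close>.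
  On the cohesive set \<open>cos \<theta>\<^sub>i\<^sub>j \<ge> cos \<gamma>\<close> and \<open>\<bar>sin \<theta>\<^sub>i\<^sub>j\<bar> \<le> sin \<gamma>\<close> along every edge, whence
  \<open>y \<bullet> J y \<le> - (cos \<phi> cos \<gamma> m - sin \<phi> sin \<gamma> d\<^sub>m\<^sub>a\<^sub>x)\<close> for unit \<open>y \<bottom> 1\<close>, where \<open>m\<close> is the minimum
  of the Laplacian form on these vectors. As \<open>\<lambda>\<^sub>2 \<le> m\<close>, the condition
  \<open>\<gamma> < \<gamma>\<^sub>b\<^sub>a\<^sub>r\<close> makes the bracket positive.

  The remaining link is \<open>\<lambda>\<^sub>2 \<le> m\<close> and \<open>m > 0\<close> (\<open>laplacian_spectral_gap\<close>).
  Connectedness gives \<open>m > 0\<close>, a minimizer of the form on \<open>1\<^sup>\<bottom>\<close> is an eigenvector for \<open>m\<close>,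
  and \<open>1\<close> is one for \<open>0\<close>. Thus \<open>0 < m\<close> are two different roots of the characteristic polynomial, and
  whatever the other roots are, the second entry of their sorted list is at most \<open>m\<close>.
\<close>

section \<open>The logarithmic seminorm as a maximal Rayleigh quotient\<close>

definition disagreement_sphere :: "(real^'n) set" where
  "disagreement_sphere = {y. y \<bullet> 1 = 0 \<and> norm y = 1}"

lemma inner_one_vec: "(y::real^'n) \<bullet> 1 = (\<Sum>i\<in>UNIV. y $ i)"
  by (simp add: inner_vec_def)

lemma consensus_proj_mult:
  "consensus_proj *v z = z - ((z \<bullet> 1) / real CARD('n)) *\<^sub>R (1 :: real^'n)"
proof -
  have "(\<chi> i j. 1 / real CARD('n)) *v z = ((z \<bullet> 1) / real CARD('n)) *\<^sub>R (1 :: real^'n)"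
    unfolding inner_one_vec
    by (simp add: vec_eq_iff matrix_vector_mult_def sum_divide_distrib)
  then show ?thesis
    by (simp add: consensus_proj_def matrix_vector_mult_diff_rdistrib)
qed

lemma consensus_seminorm_eq_norm:
  "y \<bullet> 1 = 0 \<Longrightarrow> consensus_seminorm y = norm (y :: real^'n)"
  by (simp add: consensus_seminorm_def consensus_proj_mult)

lemma consensus_seminorm_le_norm: "consensus_seminorm (z :: real^'n) \<le> norm z"
proof -
  let ?c = "(z \<bullet> 1) / real CARD('n)"
  have n: "(1 :: real^'n) \<bullet> 1 = real CARD('n)"
    by (simp add: inner_one_vec)
  have "(norm (z - ?c *\<^sub>R 1))\<^sup>2 = (norm z)\<^sup>2 - (z \<bullet> 1)\<^sup>2 / real CARD('n)"
    unfolding power2_norm_eq_inner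
    by (simp add: inner_diff inner_commute n field_simps power2_eq_square)
  also have "\<dots> \<le> (norm z)\<^sup>2"
    by simp
  finally show ?thesis
    unfolding consensus_seminorm_def consensus_proj_mult
    by (rule power2_le_imp_le) simp
qed

lemma inner_le_consensus_seminorm:
  assumes "y \<in> disagreement_sphere"
  shows "y \<bullet> z \<le> consensus_seminorm (z :: real^'n)"
proof -
  have "y \<bullet> z = y \<bullet> (consensus_proj *v z)"
    using assms by (simp add: disagreement_sphere_def consensus_proj_mult inner_diff_right)
  also have "\<dots> \<le> norm y * norm (consensus_proj *v z)"
    by (rule norm_cauchy_schwarz)
  finally show ?thesis
    using assms by (simp add: disagreement_sphere_def consensus_seminorm_def)
qed

lemma consensus_mat_seminorm_sphere:
  fixes A :: "real^'n^'n"
  shows "consensus_mat_seminorm A = (SUP y\<in>disagreement_sphere. consensus_seminorm (A *v y))"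
proof -
  have "{y. y \<bullet> 1 = 0 \<and> consensus_seminorm y = 1} = (disagreement_sphere :: (real^'n) set)"
    by (auto simp: disagreement_sphere_def consensus_seminorm_eq_norm)
  then show ?thesis
    by (simp add: consensus_mat_seminorm_def)
qed

lemma disagreement_sphere_nonempty:
  assumes "CARD('n) \<ge> 2"
  shows "(disagreement_sphere :: (real^'n) set) \<noteq> {}"
proof -
  have "\<not> card (UNIV :: 'n set) \<le> Suc 0"
    using assms by simp
  then obtain i j :: 'n where ij: "i \<noteq> j"
    by (auto simp: card_le_Suc0_iff_eq)
  let ?z = "axis i 1 - axis j 1 :: real^'n"
  have "?z $ i = 1"
    using ij by (simp add: axis_def)
  then have nz: "?z \<noteq> 0"
    by force
  have "?z \<bullet> 1 = 0"
    by (simp add: inner_diff_left inner_axis')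
  then have "(1 / norm ?z) *\<^sub>R ?z \<in> disagreement_sphere"
    using nz by (simp add: disagreement_sphere_def)
  then show ?thesis
    by blast
qed

lemma compact_disagreement_sphere: "compact (disagreement_sphere :: (real^'n) set)"
proof -
  have "disagreement_sphere = sphere (0 :: real^'n) 1 \<inter> {y. 1 \<bullet> y = 0}"
    by (auto simp: disagreement_sphere_def inner_commute)
  then show ?thesis
    by (metis compact_Int_closed compact_sphere closed_hyperplane)
qed

text \<open>
  Let \<open>m\<close> be the supremum on the right. The difference quotient at \<open>h > 0\<close> lies between \<open>m\<close> and
  \<open>m + h K\<^sup>2 / 2\<close>, where \<open>K\<close> is the operator norm of \<open>A\<close>: testing \<open>y + h A y\<close> against \<open>y\<close>
  bounds it from below, expanding the squared length of \<open>y + h A y\<close> bounds it from above. This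
  gives the existence of the limit together with its value.
\<close>

lemma consensus_log_seminorm_eq_Sup_Rayleigh:
  fixes A :: "real^'n^'n"
  assumes "CARD('n) \<ge> 2"
  shows "consensus_log_seminorm A = (SUP y\<in>disagreement_sphere. y \<bullet> (A *v y))"
proof -
  define S where "S = (disagreement_sphere :: (real^'n) set)"
  define m where "m = (SUP y\<in>S. y \<bullet> (A *v y))"
  define K where "K = onorm ((*v) A)"
  have S_ne: "S \<noteq> {}"
    using disagreement_sphere_nonempty[OF assms] by (simp add: S_def)
  have Ay: "norm (A *v y) \<le> K" if "y \<in> S" for y
    using onorm[OF matrix_vector_mul_bounded_linear, of A y] that
    by (simp add: K_def S_def disagreement_sphere_def)
  have "y \<bullet> (A *v y) \<le> K" if "y \<in> S" for y
    using norm_cauchy_schwarz[of y "A *v y"] Ay[OF that] that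
    by (simp add: S_def disagreement_sphere_def)
  then have bdd: "bdd_above ((\<lambda>y. y \<bullet> (A *v y)) ` S)"
    by (rule bdd_aboveI2)
  have m_upper: "y \<bullet> (A *v y) \<le> m" if "y \<in> S" for y
    unfolding m_def using bdd that by (rule cSUP_upper2[OF _ _ order_refl])
  let ?g = "\<lambda>h. consensus_mat_seminorm (mat 1 + h *\<^sub>R A)"
  have step: "(mat 1 + h *\<^sub>R A) *v y = y + h *\<^sub>R (A *v y)" for h y
    by (simp add: matrix_vector_mult_add_rdistrib scaleR_matrix_vector_assoc)
  have seminorm_upper: "consensus_seminorm (y + h *\<^sub>R (A *v y)) \<le> 1 + (h * m + h\<^sup>2 * K\<^sup>2 / 2)"
    if h: "h > 0" and y: "y \<in> S" for h y
  proof -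
    let ?N = "norm (y + h *\<^sub>R (A *v y))"
    have "?N\<^sup>2 = 1 + 2 * h * (y \<bullet> (A *v y)) + h\<^sup>2 * (norm (A *v y))\<^sup>2"
      using y unfolding S_def disagreement_sphere_def power2_norm_eq_inner
      by (simp add: inner_add inner_commute norm_eq_1 power2_eq_square algebra_simps)
    also have "\<dots> \<le> 1 + 2 * h * m + h\<^sup>2 * K\<^sup>2"
      using h m_upper[OF y] Ay[OF y]
      by (intro add_mono mult_left_mono power_mono) auto
    finally have "?N\<^sup>2 \<le> 1 + 2 * h * m + h\<^sup>2 * K\<^sup>2" .
    \<comment> \<open>The square root is bounded by its tangent at \<open>1\<close>.\<close>
    moreover have "2 * ?N \<le> 1 + ?N\<^sup>2"
      using zero_le_power2[of "?N - 1"] by (simp add: power2_eq_square algebra_simps)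
    ultimately have "?N \<le> 1 + (h * m + h\<^sup>2 * K\<^sup>2 / 2)"
      by simp
    then show ?thesis
      using consensus_seminorm_le_norm order_trans by blast
  qed
  have upper: "(?g h - 1) / h \<le> m + h * K\<^sup>2 / 2" if h: "h > 0" for h
  proof -
    have "?g h \<le> 1 + (h * m + h\<^sup>2 * K\<^sup>2 / 2)"
      unfolding consensus_mat_seminorm_sphere step S_def[symmetric]
      using S_ne seminorm_upper[OF h] by (rule cSUP_least)
    then show ?thesis
      using h by (simp add: field_simps power2_eq_square)
  qed
  have lower: "m \<le> (?g h - 1) / h" if h: "h > 0" for h
  proof -
    have "y \<bullet> (A *v y) \<le> (?g h - 1) / h" if y: "y \<in> S" for y
    proof -
      have "1 + h * (y \<bullet> (A *v y)) = y \<bullet> (y + h *\<^sub>R (A *v y))"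
        using y by (simp add: S_def disagreement_sphere_def inner_add_right norm_eq_1)
      also have "\<dots> \<le> consensus_seminorm (y + h *\<^sub>R (A *v y))"
        using y by (simp add: S_def inner_le_consensus_seminorm)
      also have "\<dots> \<le> ?g h"
        unfolding consensus_mat_seminorm_sphere step S_def[symmetric]
        using seminorm_upper[OF h] y by (intro cSUP_upper bdd_aboveI2) auto
      finally show ?thesis
        using h by (simp add: field_simps)
    qed
    then show ?thesis
      unfolding m_def using S_ne by (intro cSUP_least) auto
  qed
  have upper_tendsto: "((\<lambda>h. m + h * K\<^sup>2 / 2) \<longlongrightarrow> m) (at_right 0)"
    by (auto intro!: tendsto_eq_intros)
  have "((\<lambda>h. (?g h - 1) / h) \<longlongrightarrow> m) (at_right 0)"
  proof (rule tendsto_sandwich[OF _ _ tendsto_const upper_tendsto])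
    show "eventually (\<lambda>h. m \<le> (?g h - 1) / h) (at_right 0)"
      using eventually_at_right_less by (rule eventually_mono) (rule lower)
    show "eventually (\<lambda>h. (?g h - 1) / h \<le> m + h * K\<^sup>2 / 2) (at_right 0)"
      using eventually_at_right_less by (rule eventually_mono) (rule upper)
  qed
  then show ?thesis
    unfolding consensus_log_seminorm_def m_def S_def
    by (intro tendsto_Lim) auto
qed

section \<open>Weighted difference operators\<close>

text \<open>
  The common shape of the Laplacian, where \<open>w\<close> is symmetric, and of the negated Jacobian of the
  Kuramoto-Sakaguchi field, where \<open>w\<close> has a symmetric and an antisymmetric part.
\<close>

definition weighted_differences :: "('n::finite \<Rightarrow> 'n \<Rightarrow> real) \<Rightarrow> real^'n \<Rightarrow> real^'n" where
  "weighted_differences w y = (\<chi> i. \<Sum>j\<in>UNIV. w i j * (y $ i - y $ j))"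

lemma inner_weighted_differences:
  "z \<bullet> weighted_differences w y = (\<Sum>i\<in>UNIV. \<Sum>j\<in>UNIV. w i j * z $ i * (y $ i - y $ j))"
  by (simp add: weighted_differences_def inner_vec_def sum_distrib_left mult_ac)

lemma weighted_differences_combine:
  "weighted_differences (\<lambda>i j. b * u i j + c * v i j) y =
     b *\<^sub>R weighted_differences u y + c *\<^sub>R weighted_differences v y"
  by (simp add: weighted_differences_def vec_eq_iff sum_distrib_left sum.distrib[symmetric] algebra_simps)

text \<open>Summation by parts: average the double sum with its copy in which the indices are swapped.\<close>

lemma inner_weighted_differences_symmetric:
  assumes "\<And>i j. w i j = w j i"
  shows "z \<bullet> weighted_differences w y =
    (\<Sum>i\<in>UNIV. \<Sum>j\<in>UNIV. w i j * ((z $ i - z $ j) * (y $ i - y $ j))) / 2"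
proof -
  have "z \<bullet> weighted_differences w y = (\<Sum>i\<in>UNIV. \<Sum>j\<in>UNIV. w j i * z $ j * (y $ j - y $ i))"
    unfolding inner_weighted_differences by (rule sum.swap)
  also have "\<dots> = (\<Sum>i\<in>UNIV. \<Sum>j\<in>UNIV. - (w i j * z $ j * (y $ i - y $ j)))"
    by (intro sum.cong refl) (simp add: assms[of _ "_"] algebra_simps)
  finally have "2 * (z \<bullet> weighted_differences w y) =
      (\<Sum>i\<in>UNIV. \<Sum>j\<in>UNIV. w i j * z $ i * (y $ i - y $ j)) +
      (\<Sum>i\<in>UNIV. \<Sum>j\<in>UNIV. - (w i j * z $ j * (y $ i - y $ j)))"
    using inner_weighted_differences[of z w y] by linarith
  also have "\<dots> = (\<Sum>i\<in>UNIV. \<Sum>j\<in>UNIV. w i j * ((z $ i - z $ j) * (y $ i - y $ j)))"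
    unfolding sum.distrib[symmetric] by (intro sum.cong refl) (simp add: algebra_simps)
  finally show ?thesis
    by simp
qed

lemma inner_weighted_differences_antisymmetric:
  assumes "\<And>i j. w i j = - w j i"
  shows "y \<bullet> weighted_differences w y = (\<Sum>i\<in>UNIV. (\<Sum>j\<in>UNIV. w i j) * (y $ i)\<^sup>2)"
proof -
  let ?c = "\<Sum>i\<in>UNIV. \<Sum>j\<in>UNIV. w i j * (y $ i * y $ j)"
  have "?c = (\<Sum>i\<in>UNIV. \<Sum>j\<in>UNIV. w j i * (y $ j * y $ i))"
    by (rule sum.swap)
  also have "\<dots> = (\<Sum>i\<in>UNIV. \<Sum>j\<in>UNIV. - (w i j * (y $ i * y $ j)))"
    by (intro sum.cong refl) (metis assms mult.commute mult_minus_left)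
  also have "\<dots> = - ?c"
    by (simp add: sum_negf)
  finally have "?c = 0"
    by simp
  moreover have "y \<bullet> weighted_differences w y =
      (\<Sum>i\<in>UNIV. \<Sum>j\<in>UNIV. w i j * (y $ i)\<^sup>2) - ?c"
    unfolding inner_weighted_differences sum_subtractf[symmetric]
    by (intro sum.cong refl) (simp add: power2_eq_square algebra_simps)
  ultimately show ?thesis
    by (simp add: sum_distrib_right)
qed

section \<open>The spectral gap of the Laplacian\<close>

lemma laplacian_mult:
  fixes a :: "real^'n^'n"
  assumes "\<And>i. a $ i $ i = 0"
  shows "laplacian a *v y = weighted_differences (\<lambda>i j. a $ i $ j) y"
proof -
  have "(\<Sum>j\<in>UNIV. (if i = j then weighted_degree a i else - a $ i $ j) * y $ j) =
      (\<Sum>j\<in>UNIV. (if i = j then weighted_degree a i * y $ j else 0) - a $ i $ j * y $ j)" for i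
    by (intro sum.cong refl) (auto simp: assms)
  then show ?thesis
    by (simp add: vec_eq_iff matrix_vector_mult_def laplacian_def weighted_differences_def
        weighted_degree_def sum_subtractf sum_distrib_right right_diff_distrib)
qed

lemma poly_det: "poly (det A) t = det (\<chi> i j. poly (A $ i $ j) (t::'a::comm_ring_1))"
proof -
  have "poly (of_int k :: 'a poly) t = of_int k" for k
    by (simp add: of_int_poly)
  then show ?thesis
    by (simp add: det_def poly_sum poly_prod)
qed

lemma poly_charpoly_eq_0_iff:
  fixes A :: "real^'n^'n"
  shows "poly (charpoly A) t = 0 \<longleftrightarrow> (\<exists>v. v \<noteq> 0 \<and> A *v v = t *\<^sub>R v)"
proof -
  let ?B = "mat t - A"
  have "(\<chi> i j. poly (((\<chi> i j. (if i = j then [:0, 1:] else 0) - [:A $ i $ j:]) :: real poly^'n^'n) $ i $ j) t) = ?B"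
    by (simp add: vec_eq_iff mat_def)
  then have "poly (charpoly A) t = det ?B"
    unfolding charpoly_def poly_det by simp
  moreover have "mat t *v v = t *\<^sub>R v" for v :: "real^'n"
    by (simp add: vec_eq_iff mat_def matrix_vector_mult_def if_distrib[of "\<lambda>c. c * _"] cong: if_cong)
  ultimately show ?thesis
    using invertible_det_nz[of ?B] matrix_left_invertible_ker[of ?B]
    by (auto simp: invertible_left_inverse matrix_vector_mult_diff_rdistrib)
qed

text \<open>Every eigenvalue is bounded by the operator norm, so some point is not a root.\<close>

lemma charpoly_nonzero: "charpoly (A :: real^'n^'n) \<noteq> 0"
proof
  assume "charpoly A = 0"
  then obtain v where v: "v \<noteq> 0" "A *v v = (onorm ((*v) A) + 1) *\<^sub>R v"
    using poly_charpoly_eq_0_iff[of A "onorm ((*v) A) + 1"] by auto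
  have "0 \<le> onorm ((*v) A)"
    by (simp add: onorm_pos_le)
  then have "(onorm ((*v) A) + 1) * norm v = norm (A *v v)"
    using v(2) by simp
  also have "\<dots> \<le> onorm ((*v) A) * norm v"
    by (simp add: onorm)
  finally show False
    using v(1) by (simp add: algebra_simps)
qed

text \<open>
  In the sorted list of roots \<open>t\<close> stands somewhere after \<open>s\<close>, hence not at position \<open>0\<close>.
\<close>

lemma second_sorted_eigenvalue_le:
  fixes A :: "real^'n^'n"
  assumes "A *v u = s *\<^sub>R u" "u \<noteq> 0" "A *v v = t *\<^sub>R v" "v \<noteq> 0" "s < t"
  shows "sorted_eigenvalues A ! 1 \<le> t"
proof -
  let ?xs = "sorted_eigenvalues A"
  have "s \<in> set ?xs" "t \<in> set ?xs"
    using assms charpoly_nonzero[of A]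
    by (auto simp: sorted_eigenvalues_def poly_charpoly_eq_0_iff)
  then obtain p q where pq: "p < length ?xs" "q < length ?xs" "?xs ! p = s" "?xs ! q = t"
    by (metis in_set_conv_nth)
  have sorted: "sorted ?xs"
    by (simp add: sorted_eigenvalues_def)
  have "p < q"
    using sorted_nth_mono[OF sorted, of q p] pq assms(5) by force
  then show ?thesis
    using sorted_nth_mono[OF sorted, of 1 q] pq by simp
qed

text \<open>
  At a minimizer the first-order variation of the form vanishes in every direction of \<open>1\<^sup>\<bottom>\<close>; the
  residual \<open>A v - m v\<close> is itself such a direction, so it has length zero.
\<close>

lemma Rayleigh_minimizer_is_eigenvector:
  fixes A :: "real^'n^'n"
  assumes sym: "\<And>y z. z \<bullet> (A *v y) = y \<bullet> (A *v z)"
    and A1: "A *v 1 = 0"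
    and min: "\<And>y. y \<bullet> 1 = 0 \<Longrightarrow> m * (norm y)\<^sup>2 \<le> y \<bullet> (A *v y)"
    and v: "v \<bullet> 1 = 0" "v \<bullet> (A *v v) = m * (norm v)\<^sup>2"
  shows "A *v v = m *\<^sub>R v"
proof -
  define w where "w = A *v v - m *\<^sub>R v"
  define C where "C = w \<bullet> (A *v w) - m * (norm w)\<^sup>2"
  have w1: "w \<bullet> 1 = 0"
    using sym[of 1 v] A1 v(1) by (simp add: w_def inner_diff_right inner_commute[of _ 1])
  have C: "C \<ge> 0"
    using min[OF w1] by (simp add: C_def)
  have var: "2 * t * (norm w)\<^sup>2 \<le> t\<^sup>2 * C" for t
  proof -
    have variation: "m * (norm (v - t *\<^sub>R w))\<^sup>2 \<le> (v - t *\<^sub>R w) \<bullet> (A *v (v - t *\<^sub>R w))"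
      by (rule min) (simp add: inner_diff_left v w1)
    have norm_sq: "(norm (v - t *\<^sub>R w))\<^sup>2 = (norm v)\<^sup>2 - 2 * t * (w \<bullet> v) + t\<^sup>2 * (norm w)\<^sup>2"
      unfolding power2_norm_eq_inner
      by (simp add: inner_diff inner_commute power2_eq_square algebra_simps)
    have form: "(v - t *\<^sub>R w) \<bullet> (A *v (v - t *\<^sub>R w)) =
        v \<bullet> (A *v v) - 2 * t * (w \<bullet> (A *v v)) + t\<^sup>2 * (w \<bullet> (A *v w))"
      using sym[of v w]
      by (simp add: matrix_vector_mult_diff_distrib matrix_vector_mult_scaleR inner_diff
          power2_eq_square algebra_simps)
    have "2 * t * (w \<bullet> (A *v v) - m * (w \<bullet> v)) \<le> t\<^sup>2 * C"
      using variation unfolding norm_sq form v(2) by (simp add: C_def algebra_simps)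
    moreover have "w \<bullet> (A *v v) - m * (w \<bullet> v) = (norm w)\<^sup>2"
      by (simp add: power2_norm_eq_inner w_def inner_diff_right)
    ultimately show ?thesis
      by simp
  qed
  have "(norm w)\<^sup>2 = 0"
  proof (rule ccontr)
    assume "(norm w)\<^sup>2 \<noteq> 0"
    then have pos: "(norm w)\<^sup>2 > 0"
      by simp
    \<comment> \<open>A step so short that the quadratic term of \<open>var\<close> cannot compensate the linear one.\<close>
    define t where "t = (norm w)\<^sup>2 / (C + 1)"
    have "t > 0"
      using pos C by (simp add: t_def)
    moreover have "t * (2 * (norm w)\<^sup>2) \<le> t * (t * C)"
      using var[of t] by (simp add: power2_eq_square mult_ac)
    ultimately have "2 * (norm w)\<^sup>2 \<le> t * C"
      by (simp only: mult_le_cancel_left_pos)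
    also have "\<dots> \<le> (norm w)\<^sup>2"
      using C pos by (simp add: t_def field_simps)
    finally show False
      using pos by simp
  qed
  then show ?thesis
    by (simp add: w_def)
qed

text \<open>
  If the Laplacian form vanishes at \<open>y\<close>, every edge joins two vertices with the same value of \<open>y\<close>,
  and by connectedness \<open>y\<close> is constant.
\<close>

lemma laplacian_form_pos:
  fixes a :: "real^'n^'n"
  assumes G: "connected_weighted_graph a" and y: "y \<in> disagreement_sphere"
  shows "y \<bullet> (laplacian a *v y) > 0"
proof -
  have nonneg: "\<And>i j. a $ i $ j \<ge> 0" and sym: "\<And>i j. a $ i $ j = a $ j $ i"
    and diag: "\<And>i. a $ i $ i = 0" and conn: "\<And>i j. (i, j) \<in> (edges a)\<^sup>*"
    using G unfolding connected_weighted_graph_def by blast+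
  let ?E = "\<Sum>i\<in>UNIV. \<Sum>j\<in>UNIV. a $ i $ j * ((y $ i - y $ j) * (y $ i - y $ j))"
  have form: "y \<bullet> (laplacian a *v y) = ?E / 2"
    unfolding laplacian_mult[OF diag] by (rule inner_weighted_differences_symmetric[OF sym])
  have term_nonneg: "0 \<le> a $ i $ j * ((y $ i - y $ j) * (y $ i - y $ j))" for i j
    by (intro mult_nonneg_nonneg nonneg zero_le_square)
  have "?E \<noteq> 0"
  proof
    assume "?E = 0"
    then have row_zero: "(\<Sum>j\<in>UNIV. a $ i $ j * ((y $ i - y $ j) * (y $ i - y $ j))) = 0" for i
      by (subst (asm) sum_nonneg_eq_0_iff) (auto intro!: sum_nonneg term_nonneg)
    have zero: "a $ i $ j * ((y $ i - y $ j) * (y $ i - y $ j)) = 0" for i j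
      by (rule sum_nonneg_0[OF finite term_nonneg row_zero UNIV_I])
    have edge: "y $ i = y $ j" if "(i, j) \<in> edges a" for i j
      using zero[of i j] that by (auto simp: edges_def)
    have const: "y $ i = y $ j" for i j
      using conn[of i j] by (induction rule: rtrancl_induct) (simp, metis edge)
    have "y $ i = 0" for i
    proof -
      have "0 = (\<Sum>j\<in>UNIV. y $ j)"
        using y by (simp add: disagreement_sphere_def inner_one_vec)
      also have "\<dots> = (\<Sum>j\<in>(UNIV::'n set). y $ i)"
        by (rule sum.cong[OF refl const])
      finally show ?thesis
        by simp
    qed
    then have "y = 0"
      by (simp add: vec_eq_iff)
    then show False
      using y by (simp add: disagreement_sphere_def)
  qed
  moreover have "?E \<ge> 0"
    by (intro sum_nonneg term_nonneg)
  ultimately show ?thesis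
    using form by simp
qed

lemma laplacian_spectral_gap:
  fixes a :: "real^'n^'n"
  assumes "CARD('n) \<ge> 2" and G: "connected_weighted_graph a"
  obtains m where "m > 0" and "algebraic_connectivity a \<le> m"
    and "\<And>y. y \<in> disagreement_sphere \<Longrightarrow> m \<le> y \<bullet> (laplacian a *v y)"
proof -
  let ?L = "laplacian a"
  have sym: "\<And>i j. a $ i $ j = a $ j $ i" and diag: "\<And>i. a $ i $ i = 0"
    using G unfolding connected_weighted_graph_def by blast+
  have "continuous_on disagreement_sphere (\<lambda>y. y \<bullet> (?L *v y))"
    by (intro continuous_intros)
  then have "\<exists>v\<in>disagreement_sphere. \<forall>y\<in>disagreement_sphere. v \<bullet> (?L *v v) \<le> y \<bullet> (?L *v y)"
    by (rule continuous_attains_inf[OF compact_disagreement_sphere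
          disagreement_sphere_nonempty[OF assms(1)]])
  then obtain v where v: "v \<in> disagreement_sphere"
    and vmin: "\<And>y. y \<in> disagreement_sphere \<Longrightarrow> v \<bullet> (?L *v v) \<le> y \<bullet> (?L *v y)"
    by blast
  define m where "m = v \<bullet> (?L *v v)"
  have "m > 0"
    unfolding m_def by (rule laplacian_form_pos[OF G v])
  have hom: "m * (norm y)\<^sup>2 \<le> y \<bullet> (?L *v y)" if y: "y \<bullet> 1 = 0" for y
  proof (cases "y = 0")
    case False
    then have "(1 / norm y) *\<^sub>R y \<in> disagreement_sphere"
      using y by (simp add: disagreement_sphere_def)
    from vmin[OF this] show ?thesis
      using False by (simp add: m_def matrix_vector_mult_scaleR power2_eq_square field_simps)
  qed simp
  have "?L *v v = m *\<^sub>R v"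
  proof (rule Rayleigh_minimizer_is_eigenvector[OF _ _ hom])
    show "z \<bullet> (?L *v y) = y \<bullet> (?L *v z)" for y z
      by (simp add: laplacian_mult[OF diag] inner_weighted_differences_symmetric[OF sym]
          mult.commute[of "z $ _ - z $ _"])
    show "?L *v 1 = 0"
      by (simp add: laplacian_mult[OF diag] weighted_differences_def vec_eq_iff)
  qed (use v in \<open>auto simp: disagreement_sphere_def m_def\<close>)
  moreover have "?L *v 1 = 0 *\<^sub>R 1"
    by (simp add: laplacian_mult[OF diag] weighted_differences_def vec_eq_iff)
  moreover have "v \<noteq> 0"
    using v by (auto simp: disagreement_sphere_def)
  ultimately have "algebraic_connectivity a \<le> m"
    unfolding algebraic_connectivity_def
    using second_sorted_eigenvalue_le[of ?L 1 0 v m] \<open>m > 0\<close> by simp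
  then show ?thesis
    using that \<open>m > 0\<close> vmin m_def by blast
qed

section \<open>The Jacobian on the cohesive set\<close>

lemma jacobian_kuramoto_sakaguchi:
  fixes a :: "real^'n^'n"
  shows "jacobian (kuramoto_sakaguchi a \<omega> \<phi>) (at x) *v y =
    - weighted_differences (\<lambda>i j. a $ i $ j * cos (x $ i - x $ j - \<phi>)) y"
proof -
  let ?D = "\<lambda>y. - weighted_differences (\<lambda>i j. a $ i $ j * cos (x $ i - x $ j - \<phi>)) y"
  have "((\<lambda>x. kuramoto_sakaguchi a \<omega> \<phi> x $ i) has_derivative (\<lambda>y. ?D y $ i)) (at x)" for i
    unfolding kuramoto_sakaguchi_def weighted_differences_def
    by (auto intro!: derivative_eq_intros bounded_linear.has_derivative[OF bounded_linear_vec_nth]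
        simp: sum_negf[symmetric] fun_eq_iff mult_ac)
  then have deriv: "(kuramoto_sakaguchi a \<omega> \<phi> has_derivative ?D) (at x)"
    by (subst has_derivative_componentwise_within) (auto simp: Basis_vec_def inner_axis)
  then have "(kuramoto_sakaguchi a \<omega> \<phi> has_derivative
      (*v) (jacobian (kuramoto_sakaguchi a \<omega> \<phi>) (at x))) (at x)"
    unfolding jacobian_works[symmetric] by (rule differentiableI)
  then have "(*v) (jacobian (kuramoto_sakaguchi a \<omega> \<phi>) (at x)) = ?D"
    using deriv by (rule has_derivative_unique)
  then show ?thesis
    by (rule fun_cong)
qed

lemma d_cc_congruent: "\<exists>k::int. d_cc x y = x - y + 2 * pi * of_int k"
proof -
  \<comment> \<open>The number of full turns that brings \<open>x - y\<close> into \<open>[-\<pi>, \<pi>)\<close>.\<close>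
  define k where "k = - \<lfloor>(x - y + pi) / (2 * pi)\<rfloor>"
  have fl: "of_int (- k) \<le> (x - y + pi) / (2 * pi)" "(x - y + pi) / (2 * pi) < of_int (- k) + 1"
    using floor_correct[of "(x - y + pi) / (2 * pi)"] by (simp_all add: k_def)
  have bounds: "- pi \<le> x - y + 2 * pi * of_int k" "x - y + 2 * pi * of_int k < pi"
    using fl by (auto simp: field_simps)
  have uniq: "d = x - y + 2 * pi * of_int k"
    if cand: "(\<exists>k::int. d = x - y + 2 * pi * of_int k) \<and> - pi \<le> d \<and> d < pi" for d
  proof -
    obtain l :: int where l: "d = x - y + 2 * pi * of_int l"
      using cand by blast
    have "2 * pi * (of_int l - of_int k) < 2 * pi * 1" "2 * pi * (of_int k - of_int l) < 2 * pi * 1"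
      using cand bounds by (simp_all add: l algebra_simps)
    then have "of_int l - of_int k < (1::real)" "of_int k - of_int l < (1::real)"
      by (simp_all only: mult_less_cancel_left_pos pi_gt_zero mult_pos_pos zero_less_numeral)
    then have "l = k"
      by linarith
    then show ?thesis
      by (simp add: l)
  qed
  have "d_cc x y = x - y + 2 * pi * of_int k"
    unfolding d_cc_def using bounds uniq by (intro the_equality) auto
  then show ?thesis
    by blast
qed

lemma cohesive_edge_bounds:
  assumes x: "x \<in> cohesive_set a \<gamma>" and e: "a $ i $ j > 0" and \<gamma>: "\<gamma> < pi / 2"
  shows "cos \<gamma> \<le> cos (x $ i - x $ j)" and "\<bar>sin (x $ i - x $ j)\<bar> \<le> sin \<gamma>"
proof -
  let ?d = "d_cc (x $ i) (x $ j)"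
  have d: "\<bar>?d\<bar> \<le> \<gamma>"
    using x e by (auto simp: cohesive_set_def edges_def)
  obtain k :: int where k: "?d = x $ i - x $ j + 2 * pi * of_int k"
    using d_cc_congruent by blast
  have c: "cos ?d = cos (x $ i - x $ j)" and s: "sin ?d = sin (x $ i - x $ j)"
    unfolding k by (simp_all add: cos_add sin_add cos_int_2pin sin_int_2pin)
  have "cos \<gamma> \<le> cos \<bar>?d\<bar>"
    using d \<gamma> by (intro cos_monotone_0_pi_le) auto
  then show "cos \<gamma> \<le> cos (x $ i - x $ j)"
    by (simp add: c)
  have "sin ?d \<le> sin \<gamma>" "sin (- \<gamma>) \<le> sin ?d"
    using d \<gamma> by (intro sin_monotone_2pi_le; linarith)+
  then show "\<bar>sin (x $ i - x $ j)\<bar> \<le> sin \<gamma>"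
    by (simp add: s abs_le_iff)
qed

text \<open>
  The cosine weights dominate \<open>cos \<gamma>\<close> times the graph weights entry by entry, so their form
  dominates that of the Laplacian; the row sums of the sine weights are at least \<open>- sin \<gamma>\<close> times
  the degrees.
\<close>

lemma jacobian_form_le:
  fixes a :: "real^'n^'n"
  assumes G: "connected_weighted_graph a" and \<phi>: "0 \<le> \<phi>" "\<phi> \<le> pi / 2"
    and \<gamma>: "0 \<le> \<gamma>" "\<gamma> < pi / 2" and x: "x \<in> cohesive_set a \<gamma>"
  shows "y \<bullet> (jacobian (kuramoto_sakaguchi a \<omega> \<phi>) (at x) *v y) \<le>
    sin \<phi> * sin \<gamma> * max_degree a * (norm y)\<^sup>2 - cos \<phi> * cos \<gamma> * (y \<bullet> (laplacian a *v y))"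
proof -
  have nonneg: "\<And>i j. a $ i $ j \<ge> 0" and sym: "\<And>i j. a $ i $ j = a $ j $ i"
    and diag: "\<And>i. a $ i $ i = 0"
    using G unfolding connected_weighted_graph_def by blast+
  let ?\<theta> = "\<lambda>i j. x $ i - x $ j"
  let ?C = "\<lambda>i j. a $ i $ j * cos (?\<theta> i j)"
  let ?S = "\<lambda>i j. a $ i $ j * sin (?\<theta> i j)"
  have "(\<lambda>i j. a $ i $ j * cos (?\<theta> i j - \<phi>)) = (\<lambda>i j. cos \<phi> * ?C i j + sin \<phi> * ?S i j)"
    by (intro ext, simp only: cos_diff[of "_ - _" \<phi>]) (simp add: distrib_left mult_ac)
  then have split: "y \<bullet> (jacobian (kuramoto_sakaguchi a \<omega> \<phi>) (at x) *v y) =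
      - cos \<phi> * (y \<bullet> weighted_differences ?C y) - sin \<phi> * (y \<bullet> weighted_differences ?S y)"
    by (simp only: jacobian_kuramoto_sakaguchi weighted_differences_combine)
      (simp add: inner_diff_right)
  have C_sym: "?C i j = ?C j i" for i j
    using sym[of i j] cos_minus[of "?\<theta> i j"] by simp
  have S_antisym: "?S i j = - ?S j i" for i j
    using sym[of i j] sin_minus[of "?\<theta> i j"] by simp
  have C_ge: "cos \<gamma> * a $ i $ j \<le> ?C i j" for i j
    using cohesive_edge_bounds(1)[OF x _ \<gamma>(2), of i j] nonneg[of i j]
    by (cases "a $ i $ j = 0") (auto simp: mult.commute)
  have S_ge: "- sin \<gamma> * a $ i $ j \<le> ?S i j" for i j
  proof (cases "a $ i $ j = 0")
    case False
    then have "a $ i $ j > 0"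
      using nonneg[of i j] by simp
    moreover from this have "- sin \<gamma> \<le> sin (?\<theta> i j)"
      using cohesive_edge_bounds(2)[OF x _ \<gamma>(2), of i j] by linarith
    ultimately show ?thesis
      by (metis mult.commute mult_le_cancel_left_pos)
  qed simp
  have "cos \<gamma> * (y \<bullet> (laplacian a *v y)) =
      (\<Sum>i\<in>UNIV. \<Sum>j\<in>UNIV. cos \<gamma> * a $ i $ j * ((y $ i - y $ j) * (y $ i - y $ j))) / 2"
    by (simp add: laplacian_mult[OF diag] inner_weighted_differences_symmetric[OF sym]
        sum_distrib_left mult.assoc)
  also have "\<dots> \<le> (\<Sum>i\<in>UNIV. \<Sum>j\<in>UNIV. ?C i j * ((y $ i - y $ j) * (y $ i - y $ j))) / 2"
    by (intro divide_right_mono sum_mono mult_right_mono C_ge) auto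
  also have "\<dots> = y \<bullet> weighted_differences ?C y"
    by (rule inner_weighted_differences_symmetric[OF C_sym, symmetric])
  finally have C_form: "cos \<gamma> * (y \<bullet> (laplacian a *v y)) \<le> y \<bullet> weighted_differences ?C y" .
  have sin\<gamma>: "sin \<gamma> \<ge> 0"
    using \<gamma> by (intro sin_ge_zero) auto
  have row: "- sin \<gamma> * max_degree a \<le> (\<Sum>j\<in>UNIV. ?S i j)" for i
  proof -
    have "weighted_degree a i \<le> max_degree a"
      by (simp add: max_degree_def)
    then have "sin \<gamma> * weighted_degree a i \<le> sin \<gamma> * max_degree a"
      using sin\<gamma> by (rule mult_left_mono)
    then have "- sin \<gamma> * max_degree a \<le> (\<Sum>j\<in>UNIV. - sin \<gamma> * a $ i $ j)"
      by (simp add: weighted_degree_def sum_distrib_left sum_negf)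
    also have "\<dots> \<le> (\<Sum>j\<in>UNIV. ?S i j)"
      by (intro sum_mono S_ge)
    finally show ?thesis .
  qed
  have "- sin \<gamma> * max_degree a * (norm y)\<^sup>2 = (\<Sum>i\<in>UNIV. - sin \<gamma> * max_degree a * (y $ i)\<^sup>2)"
    unfolding power2_norm_eq_inner inner_vec_def
    by (simp add: sum_distrib_left power2_eq_square sum_negf)
  also have "\<dots> \<le> (\<Sum>i\<in>UNIV. (\<Sum>j\<in>UNIV. ?S i j) * (y $ i)\<^sup>2)"
    by (intro sum_mono mult_right_mono row) auto
  also have "\<dots> = y \<bullet> weighted_differences ?S y"
    by (rule inner_weighted_differences_antisymmetric[OF S_antisym, symmetric])
  finally have S_form: "- sin \<gamma> * max_degree a * (norm y)\<^sup>2 \<le> y \<bullet> weighted_differences ?S y" .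
  have "cos \<phi> \<ge> 0" "sin \<phi> \<ge> 0"
    using \<phi> by (auto intro: cos_ge_zero sin_ge_zero)
  then show ?thesis
    using mult_left_mono[OF C_form, of "cos \<phi>"] mult_left_mono[OF S_form, of "sin \<phi>"]
    unfolding split by (simp add: algebra_simps)
qed

section \<open>Semicontraction\<close>

lemma max_degree_nonneg:
  fixes a :: "real^'n^'n"
  assumes "connected_weighted_graph a"
  shows "max_degree a \<ge> 0"
proof -
  fix i :: 'n
  have "0 \<le> weighted_degree a i"
    using assms unfolding connected_weighted_graph_def weighted_degree_def by (simp add: sum_nonneg)
  also have "\<dots> \<le> max_degree a"
    by (simp add: max_degree_def)
  finally show "max_degree a \<ge> 0" .
qed

lemma gamma_bar_le_pi_half: "gamma_bar a \<phi> \<le> pi / 2"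
  using arctan_ubound less_imp_le by (auto simp: gamma_bar_def)

text \<open>
  For \<open>0 < \<phi> < \<pi>/2\<close> this is \<open>\<gamma> < \<gamma>\<^sub>b\<^sub>a\<^sub>r\<close> after applying \<open>tan\<close> and multiplying by
  \<open>cos \<phi> cos \<gamma>\<close>. For \<open>\<phi> = 0\<close> the degree term vanishes and \<open>m > 0\<close> decides; \<open>\<phi> = \<pi>/2\<close> is
  excluded by \<open>0 < \<gamma> < \<gamma>\<^sub>b\<^sub>a\<^sub>r = 0\<close>.
\<close>

lemma contraction_rate_pos:
  fixes a :: "real^'n^'n"
  assumes G: "connected_weighted_graph a" and \<phi>: "0 \<le> \<phi>" "\<phi> \<le> pi / 2"
    and \<gamma>: "0 < \<gamma>" "\<gamma> < gamma_bar a \<phi>"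
    and m: "0 < m" "algebraic_connectivity a \<le> m"
  shows "sin \<phi> * sin \<gamma> * max_degree a < cos \<phi> * cos \<gamma> * m"
proof -
  have "\<gamma> < pi / 2"
    using \<gamma>(2) gamma_bar_le_pi_half[of a \<phi>] by linarith
  then have cos\<gamma>: "cos \<gamma> > 0"
    using \<gamma>(1) by (intro cos_gt_zero) auto
  show ?thesis
  proof (cases "\<phi> = 0")
    case True
    then show ?thesis
      using cos\<gamma> m(1) by simp
  next
    case False
    with \<phi> \<gamma> have \<phi>': "0 < \<phi>" "\<phi> < pi / 2"
      and bar: "\<gamma> < arctan (algebraic_connectivity a / (max_degree a * tan \<phi>))"
      by (auto simp: gamma_bar_def split: if_splits)
    let ?q = "algebraic_connectivity a / (max_degree a * tan \<phi>)"
    have cos\<phi>: "cos \<phi> > 0" and tan\<phi>: "tan \<phi> > 0"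
      using \<phi>' by (auto intro: cos_gt_zero tan_gt_zero)
    have tan\<gamma>: "0 < tan \<gamma>"
      using \<gamma>(1) \<open>\<gamma> < pi / 2\<close> by (rule tan_gt_zero)
    have "arctan (tan \<gamma>) = \<gamma>"
      using \<gamma>(1) \<open>\<gamma> < pi / 2\<close> by (intro arctan_tan) auto
    then have q: "tan \<gamma> < ?q"
      using bar arctan_less_iff[of "tan \<gamma>" ?q] by simp
    \<comment> \<open>A vanishing denominator would make the quotient zero.\<close>
    then have "max_degree a * tan \<phi> \<noteq> 0"
      using tan\<gamma> by (metis div_by_0 order_less_asym)
    then have "max_degree a * tan \<phi> > 0"
      using max_degree_nonneg[OF G] tan\<phi> by simp
    then have "tan \<gamma> * (max_degree a * tan \<phi>) < m"
      using q m(2) by (simp add: pos_less_divide_eq)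
    then have "(cos \<phi> * cos \<gamma>) * (tan \<gamma> * (max_degree a * tan \<phi>)) < (cos \<phi> * cos \<gamma>) * m"
      using cos\<phi> cos\<gamma> by (intro mult_strict_left_mono) auto
    moreover have "(cos \<phi> * cos \<gamma>) * (tan \<gamma> * (max_degree a * tan \<phi>)) = sin \<phi> * sin \<gamma> * max_degree a"
      using cos\<phi> cos\<gamma> by (simp add: tan_def)
    ultimately show ?thesis
      by simp
  qed
qed

theorem theorem3:
  fixes a :: "real^'n^'n" and \<omega> :: "real^'n" and \<phi> \<gamma> :: real
  assumes "CARD('n) \<ge> 2"
    and "connected_weighted_graph a"
    and "0 \<le> \<phi>" and "\<phi> \<le> pi / 2"
    and "0 < \<gamma>" and "\<gamma> < gamma_bar a \<phi>"
  shows "strongly_infinitesimally_semicontracting (kuramoto_sakaguchi a \<omega> \<phi>) (cohesive_set a \<gamma>)"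
proof -
  obtain m where m: "m > 0" "algebraic_connectivity a \<le> m"
    and gap: "\<And>y. y \<in> disagreement_sphere \<Longrightarrow> m \<le> y \<bullet> (laplacian a *v y)"
    using laplacian_spectral_gap[OF assms(1,2)] by blast
  define c where "c = cos \<phi> * cos \<gamma> * m - sin \<phi> * sin \<gamma> * max_degree a"
  have "c > 0"
    using contraction_rate_pos[OF assms(2-6) m] by (simp add: c_def)
  moreover have "consensus_log_seminorm (jacobian (kuramoto_sakaguchi a \<omega> \<phi>) (at x)) \<le> - c"
    if x: "x \<in> cohesive_set a \<gamma>" for x
  proof -
    let ?J = "jacobian (kuramoto_sakaguchi a \<omega> \<phi>) (at x)"
    have \<gamma>2: "\<gamma> < pi / 2"
      using assms(6) gamma_bar_le_pi_half[of a \<phi>] by linarith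
    have coef: "cos \<phi> * cos \<gamma> \<ge> 0"
      using assms(3-5) \<gamma>2 by (intro mult_nonneg_nonneg cos_ge_zero) auto
    have "y \<bullet> (?J *v y) \<le> - c" if y: "y \<in> disagreement_sphere" for y
      using jacobian_form_le[OF assms(2-4) less_imp_le[OF assms(5)] \<gamma>2 x, of y \<omega>]
        mult_left_mono[OF gap[OF y] coef] y
      by (simp add: c_def disagreement_sphere_def)
    then show ?thesis
      unfolding consensus_log_seminorm_eq_Sup_Rayleigh[OF assms(1)]
      using disagreement_sphere_nonempty[OF assms(1)] by (intro cSUP_least)
  qed
  ultimately show ?thesis
    unfolding strongly_infinitesimally_semicontracting_def by blast
qed

end
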